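(* Let $p,q\ge 1$ and let $\mathrm d\mu$ be a $q\times p$ matrix of measures on an interval $\Delta\subseteq\mathbb R$ with all moments finite. Suppose that the Gauss--Borel factorizations $\mathscr M_L^{(k)}=(\mathscr L_L^{(k)})^{-1}(\mathscr U_L^{(k)})^{-1}$ exist for $k=0,\ldots,p$ and $\mathscr M_R^{(k)}=(\mathscr L_R^{(k)})^{-1}(\mathscr U_R^{(k)})^{-1}$ exist for $k=0,\ldots,q$. Let $L_1,\ldots,L_p$ be the lower bidiagonal matrices with unit diagonal determined by $(\mathscr U_L^{(k-1)})^{-1}\Lambda^\top=L_k(\mathscr U_L^{(k)})^{-1}$, equivalently $\mathscr L_L^{(k)}=L_k^{-1}\mathscr L_L^{(k-1)}$, $1\le k\le p$, and let $U_1,\ldots,U_q$ be the upper bidiagonal matrices with unit superdiagonal determined by $\Lambda(\mathscr L_R^{(k-1)})^{-1}=(\mathscr L_R^{(k)})^{-1}U_k$, equivalently $\mathscr U_R^{(k)}=\mathscr U_R^{(k-1)}U_k^{-1}$, $1\le k\le q$. Then the banded recurrence matrix $T$ has the bidiagonal factorization $$T=L_1\cdots L_p\,U_q\cdots U_1 .$$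
   Context: All semi-infinite matrices have rows and columns indexed by $\mathbb N_0$; identities between them are understood entrywise (all sums involved are finite). $I_r$ is the $r\times r$ identity and $X_{[r]}(x)=\begin{bmatrix} I_r\\ xI_r\\ x^2I_r\\ \vdots\end{bmatrix}$. The moment matrix of a $q\times p$ matrix of measures $\mathrm d\mu$ is $\mathscr M(\mu)=\int_\Delta X_{[q]}(x)\,\mathrm d\mu(x)\,X_{[p]}^\top(x)$. $\Lambda$ is the shift matrix with $\Lambda_{n,n+1}=1$ and all other entries $0$. A Gauss--Borel factorization of a semi-infinite matrix $\mathscr M$ is $\mathscr M=\mathscr L^{-1}\mathscr U^{-1}$ with $\mathscr L$ lower unitriangular and $\mathscr U$ nonsingular upper triangular (it is unique when it exists). Christoffel perturbations: let $\mathfrak X_{[r]}(x)$ be the $r\times r$ matrix with entries $1$ on the first superdiagonal, entry $x$ in position $(r,1)$, and $0$ elsewhere (for $r=1$, $\mathfrak X_{[1]}(x)=x$), so $\mathfrak X_{[r]}^r=xI_r$. Put $\mathrm d\mu_L^{(k)}=\mathrm d\mu\,(\mathfrak X_{[p]}^k)^\top$ and $\mathrm d\mu_R^{(k)}=\mathfrak X_{[q]}^k\,\mathrm d\mu$. Their moment matrices are $\mathscr M_L^{(k)}=\mathscr M(\mu)(\Lambda^k)^\top$ and $\mathscr M_R^{(k)}=\Lambda^k\mathscr M(\mu)$. For $k=0$ both are $\mathscr M(\mu)$ and the corresponding factors are written $\mathscr L=\mathscr L_L^{(0)}=\mathscr L_R^{(0)}$, $\mathscr U=\mathscr U_L^{(0)}=\mathscr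 U_R^{(0)}$. The banded recurrence matrix is $T=\mathscr L\,\Lambda^q\,\mathscr L^{-1}=\mathscr U^{-1}(\Lambda^p)^\top\mathscr U$ (the two expressions agree because $\Lambda^q\mathscr M=\mathscr M(\Lambda^p)^\top$). *)

theory Defs
  imports
    "HOL-Analysis.Bochner_Integration"
    "HOL-Analysis.Borel_Space"
    "HOL-Analysis.Topology_Euclidean_Space"
    "HOL-Library.Groups_Big_Fun"
    "Jordan_Normal_Form.Matrix"
begin

section \<open>Semi-infinite matrices\<close>

type_synonym smat = "nat \<Rightarrow> nat \<Rightarrow> real"

text \<open>Each entry of a product is a sum over the support of its summands. It has the
  intended value when that support is finite, as it is in every product used here.\<close>

definition smult_mat :: "smat \<Rightarrow> smat \<Rightarrow> smat" (infixl "\<star>" 70) where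
  "A \<star> B = (\<lambda>i j. Sum_any (\<lambda>k. A i k * B k j))"

definition sid :: smat where
  "sid = (\<lambda>i j. if i = j then 1 else 0)"

primrec spow :: "smat \<Rightarrow> nat \<Rightarrow> smat" where
  "spow A 0 = sid"
| "spow A (Suc k) = A \<star> spow A k"

definition stranspose :: "smat \<Rightarrow> smat" where
  "stranspose A = (\<lambda>i j. A j i)"

definition sprod :: "smat list \<Rightarrow> smat" where
  "sprod As = foldr (\<star>) As sid"

definition is_sinverse :: "smat \<Rightarrow> smat \<Rightarrow> bool" where
  "is_sinverse A B \<longleftrightarrow> A \<star> B = sid \<and> B \<star> A = sid"

definition snonsingular :: "smat \<Rightarrow> bool" where
  "snonsingular A \<longleftrightarrow> (\<exists>B. is_sinverse A B)"

text \<open>Only used for triangular matrices with nonzero diagonal, whose two-sided inverse exists and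
  is unique (for general semi-infinite matrices it need not be unique).\<close>

definition sinverse :: "smat \<Rightarrow> smat" where
  "sinverse A = (THE B. is_sinverse A B)"

definition shift :: smat  ("\<Lambda>") where
  "\<Lambda> = (\<lambda>i j. if j = Suc i then 1 else 0)"

definition lower_unitriangular :: "smat \<Rightarrow> bool" where
  "lower_unitriangular A \<longleftrightarrow> (\<forall>i. A i i = 1) \<and> (\<forall>i j. i < j \<longrightarrow> A i j = 0)"

definition supper_triangular :: "smat \<Rightarrow> bool" where
  "supper_triangular A \<longleftrightarrow> (\<forall>i j. j < i \<longrightarrow> A i j = 0)"

definition unit_lower_bidiagonal :: "smat \<Rightarrow> bool" where
  "unit_lower_bidiagonal A \<longleftrightarrow>
     (\<forall>i. A i i = 1) \<and> (\<forall>i j. j \<noteq> i \<and> i \<noteq> Suc j \<longrightarrow> A i j = 0)"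

definition unit_upper_bidiagonal :: "smat \<Rightarrow> bool" where
  "unit_upper_bidiagonal A \<longleftrightarrow>
     (\<forall>i. A i (Suc i) = 1) \<and> (\<forall>i j. j \<noteq> i \<and> j \<noteq> Suc i \<longrightarrow> A i j = 0)"

definition gauss_borel :: "smat \<Rightarrow> smat \<Rightarrow> smat \<Rightarrow> bool" where
  "gauss_borel M L U \<longleftrightarrow>
     lower_unitriangular L \<and> supper_triangular U \<and> snonsingular U \<and>
     M = sinverse L \<star> sinverse U"

section \<open>Matrices of measures and their moment matrices\<close>

text \<open>A real (possibly signed) measure is given by two nonnegative measures, of which it is the
  difference, for instance its Jordan decomposition. A nonnegative measure has zero second
  component. The moment conditions below, with exponent 0, make both components finite.\<close>

type_synonym real_measure = "real measure \<times> real measure"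

definition real_measure_on :: "real set \<Rightarrow> real_measure \<Rightarrow> bool" where
  "real_measure_on \<Delta> \<nu> \<longleftrightarrow>
     sets (fst \<nu>) = sets (restrict_space borel \<Delta>) \<and> sets (snd \<nu>) = sets (restrict_space borel \<Delta>)"

definition finite_moments :: "real_measure \<Rightarrow> bool" where
  "finite_moments \<nu> \<longleftrightarrow>
     (\<forall>n::nat. integrable (fst \<nu>) (\<lambda>x. x ^ n) \<and> integrable (snd \<nu>) (\<lambda>x. x ^ n))"

definition rm_integral :: "real_measure \<Rightarrow> (real \<Rightarrow> real) \<Rightarrow> real" where
  "rm_integral \<nu> f = integral\<^sup>L (fst \<nu>) f - integral\<^sup>L (snd \<nu>) f"

text \<open>The entries \<open>\<mu> b a\<close> with \<open>b < q\<close>, \<open>a < p\<close> form a \<open>q \<times> p\<close> matrix; finite matrices are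
  indexed from 0.\<close>

definition matrix_of_measures ::
    "nat \<Rightarrow> nat \<Rightarrow> real set \<Rightarrow> (nat \<Rightarrow> nat \<Rightarrow> real_measure) \<Rightarrow> bool" where
  "matrix_of_measures q p \<Delta> \<mu> \<longleftrightarrow>
     (\<forall>b<q. \<forall>a<p. real_measure_on \<Delta> (\<mu> b a) \<and> finite_moments (\<mu> b a))"

text \<open>The semi-infinite column of blocks \<open>I\<^sub>r, x I\<^sub>r, x\<^sup>2 I\<^sub>r, \<dots>\<close>: row \<open>n\<close> is row \<open>n mod r\<close> of the
  block with index \<open>n div r\<close>.\<close>

definition monomial_blocks :: "nat \<Rightarrow> real \<Rightarrow> smat" where
  "monomial_blocks r x = (\<lambda>n b. x ^ (n div r) * 1\<^sub>m r $$ (n mod r, b))"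

text \<open>The moment matrix of the \<open>q \<times> p\<close> matrix of measures \<open>A d\<mu> B\<close>, where \<open>A\<close> and \<open>B\<close> are
  \<open>q \<times> q\<close> and \<open>p \<times> p\<close> matrix-valued functions: the integral of
  \<open>X\<^sub>q(x) A(x) d\<mu>(x) B(x) X\<^sub>p(x)\<^sup>T\<close>. The moment matrix of \<open>d\<mu>\<close> is the case
  in which \<open>A\<close> and \<open>B\<close> are constantly the identity.\<close>

definition moment_matrix ::
    "nat \<Rightarrow> nat \<Rightarrow> (real \<Rightarrow> real mat) \<Rightarrow> (nat \<Rightarrow> nat \<Rightarrow> real_measure) \<Rightarrow> (real \<Rightarrow> real mat) \<Rightarrow> smat"
  where
  "moment_matrix q p A \<mu> B = (\<lambda>i j. \<Sum>b<q. \<Sum>a<p. rm_integral (\<mu> b a)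
     (\<lambda>x. (\<Sum>c<q. monomial_blocks q x i c * A x $$ (c, b)) *
          (\<Sum>d<p. B x $$ (a, d) * monomial_blocks p x j d)))"

definition christoffel_mat :: "nat \<Rightarrow> real \<Rightarrow> real mat" where
  "christoffel_mat r x = mat r r (\<lambda>(i, j).
     if j = Suc i then 1 else if Suc i = r \<and> j = 0 then x else 0)"

definition moment_matrix_L :: "nat \<Rightarrow> nat \<Rightarrow> (nat \<Rightarrow> nat \<Rightarrow> real_measure) \<Rightarrow> nat \<Rightarrow> smat" where
  "moment_matrix_L q p \<mu> k =
     moment_matrix q p (\<lambda>x. 1\<^sub>m q) \<mu> (\<lambda>x. transpose_mat (christoffel_mat p x ^\<^sub>m k))"

definition moment_matrix_R :: "nat \<Rightarrow> nat \<Rightarrow> (nat \<Rightarrow> nat \<Rightarrow> real_measure) \<Rightarrow> nat \<Rightarrow> smat" where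
  "moment_matrix_R q p \<mu> k =
     moment_matrix q p (\<lambda>x. christoffel_mat q x ^\<^sub>m k) \<mu> (\<lambda>x. 1\<^sub>m p)"

section \<open>The recurrence matrix and its bidiagonal factors\<close>

definition recurrence_matrix :: "nat \<Rightarrow> smat \<Rightarrow> smat" where
  "recurrence_matrix q L = L \<star> spow \<Lambda> q \<star> sinverse L"

definition is_lower_factor :: "(nat \<Rightarrow> smat) \<Rightarrow> nat \<Rightarrow> smat \<Rightarrow> bool" where
  "is_lower_factor UL k L \<longleftrightarrow> unit_lower_bidiagonal L \<and>
     sinverse (UL (k - 1)) \<star> stranspose \<Lambda> = L \<star> sinverse (UL k)"

definition is_upper_factor :: "(nat \<Rightarrow> smat) \<Rightarrow> nat \<Rightarrow> smat \<Rightarrow> bool" where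
  "is_upper_factor LR k U \<longleftrightarrow> unit_upper_bidiagonal U \<and>
     \<Lambda> \<star> sinverse (LR (k - 1)) = sinverse (LR k) \<star> U"

definition lower_factor :: "(nat \<Rightarrow> smat) \<Rightarrow> nat \<Rightarrow> smat" where
  "lower_factor UL k = (THE L. is_lower_factor UL k L)"

definition upper_factor :: "(nat \<Rightarrow> smat) \<Rightarrow> nat \<Rightarrow> smat" where
  "upper_factor LR k = (THE U. is_upper_factor LR k U)"

end

theory Submission
  imports Defs
begin

text \<open>The factors are \<open>L\<^sub>k = \<L>\<^sub>L\<^sup>(\<^sup>k\<^sup>-\<^sup>1\<^sup>) (\<L>\<^sub>L\<^sup>(\<^sup>k\<^sup>))\<^sup>-\<^sup>1\<close> and
  \<open>U\<^sub>k = \<L>\<^sub>R\<^sup>(\<^sup>k\<^sup>) \<Lambda> (\<L>\<^sub>R\<^sup>(\<^sup>k\<^sup>-\<^sup>1\<^sup>))\<^sup>-\<^sup>1\<close>.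
  The first is visibly lower unitriangular; rewriting it by means of the upper triangular factors
  shows that it has a single subdiagonal. The second is treated
  symmetrically. The products telescope to \<open>\<L> (\<L>\<^sub>L\<^sup>(\<^sup>p\<^sup>))\<^sup>-\<^sup>1\<close> and
  \<open>\<L>\<^sub>R\<^sup>(\<^sup>q\<^sup>) \<Lambda>\<^sup>q \<L>\<^sup>-\<^sup>1\<close>. Since \<open>\<Lambda>\<^sup>q \<M> = \<M> (\<Lambda>\<^sup>p)\<^sup>T\<close>, uniqueness of the
  Gauss--Borel factorization gives \<open>\<L>\<^sub>L\<^sup>(\<^sup>p\<^sup>) = \<L>\<^sub>R\<^sup>(\<^sup>q\<^sup>)\<close>, and the two middle terms cancel.\<close>

section \<open>Products of row-finite and column-finite matrices\<close>

text \<open>The product of semi-infinite matrices is not associative in general. Every reassociation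
  below rests on one of these two finiteness conditions: lower triangular matrices and
  \<open>\<Lambda>\<close> are row-finite, upper triangular matrices and the transpose of
  \<open>\<Lambda>\<close> are column-finite.\<close>

definition row_finite :: "smat \<Rightarrow> bool" where
  "row_finite A \<longleftrightarrow> (\<forall>i. finite {k. A i k \<noteq> 0})"

definition col_finite :: "smat \<Rightarrow> bool" where
  "col_finite A \<longleftrightarrow> (\<forall>j. finite {k. A k j \<noteq> 0})"

lemma smult_mat_eq_sum:
  assumes "finite S" and "\<And>k. k \<notin> S \<Longrightarrow> A i k * B k j = 0"
  shows "(A \<star> B) i j = (\<Sum>k\<in>S. A i k * B k j)"
  unfolding smult_mat_def
  by (rule Sum_any.expand_superset) (use assms in auto)

lemma stranspose_stranspose [simp]: "stranspose (stranspose A) = A"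
  by (simp add: stranspose_def)

lemma stranspose_smult_mat: "stranspose (A \<star> B) = stranspose B \<star> stranspose A"
  by (simp add: stranspose_def smult_mat_def mult.commute)

lemma row_finite_stranspose [simp]: "row_finite (stranspose A) \<longleftrightarrow> col_finite A"
  by (simp add: row_finite_def col_finite_def stranspose_def)

text \<open>Row \<open>i\<close> of \<open>A\<close> meets finitely many rows of \<open>B\<close>,
  whose supports have the finite union \<open>S\<close>. Both sides are therefore sums over the
  finite rectangle \<open>R\<close> times \<open>S\<close>, for arbitrary \<open>C\<close>.\<close>

lemma smult_mat_assoc_row_row:
  assumes "row_finite A" "row_finite B"
  shows "A \<star> B \<star> C = A \<star> (B \<star> C)"
proof (intro ext)
  fix i j
  define R where "R = {k. A i k \<noteq> 0}"
  define S where "S = (\<Union>k\<in>R. {l. B k l \<noteq> 0})"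
  have fin: "finite R" "finite S"
    using assms by (auto simp: R_def S_def row_finite_def)
  have AB: "(A \<star> B) i l = (\<Sum>k\<in>R. A i k * B k l)" for l
    by (rule smult_mat_eq_sum) (use fin in \<open>auto simp: R_def\<close>)
  have "(A \<star> B) i l = 0" if "l \<notin> S" for l
    unfolding AB by (rule sum.neutral) (use that in \<open>auto simp: S_def\<close>)
  then have "(A \<star> B \<star> C) i j = (\<Sum>l\<in>S. (A \<star> B) i l * C l j)"
    using fin by (intro smult_mat_eq_sum) auto
  also have "\<dots> = (\<Sum>k\<in>R. \<Sum>l\<in>S. A i k * (B k l * C l j))"
    unfolding AB sum_distrib_right by (subst sum.swap) (simp add: mult.assoc)
  also have "\<dots> = (\<Sum>k\<in>R. A i k * (B \<star> C) k j)"
  proof (rule sum.cong)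
    fix k assume "k \<in> R"
    then have "(B \<star> C) k j = (\<Sum>l\<in>S. B k l * C l j)"
      using fin by (intro smult_mat_eq_sum) (auto simp: S_def)
    then show "(\<Sum>l\<in>S. A i k * (B k l * C l j)) = A i k * (B \<star> C) k j"
      by (simp add: sum_distrib_left)
  qed simp
  also have "\<dots> = (A \<star> (B \<star> C)) i j"
    using fin by (intro smult_mat_eq_sum [symmetric]) (auto simp: R_def)
  finally show "(A \<star> B \<star> C) i j = (A \<star> (B \<star> C)) i j" .
qed

text \<open>Transposition exchanges rows with columns and reverses products, which reduces this to
  the row-finite case.\<close>

lemma smult_mat_assoc_col_col:
  assumes "col_finite B" "col_finite C"
  shows "A \<star> B \<star> C = A \<star> (B \<star> C)"
proof -
  have "stranspose (A \<star> B \<star> C) = stranspose (A \<star> (B \<star> C))"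
    using assms by (simp add: stranspose_smult_mat smult_mat_assoc_row_row)
  then show ?thesis
    by (metis stranspose_stranspose)
qed

text \<open>The outer factors alone confine the double sum to a finite rectangle. This is the form
  for a moment matrix in the middle, which may have full rows and columns.\<close>

lemma smult_mat_assoc_row_col:
  assumes "row_finite A" "col_finite C"
  shows "A \<star> B \<star> C = A \<star> (B \<star> C)"
proof (intro ext)
  fix i j
  define R where "R = {k. A i k \<noteq> 0}"
  define S where "S = {l. C l j \<noteq> 0}"
  have fin: "finite R" "finite S"
    using assms by (auto simp: R_def S_def row_finite_def col_finite_def)
  have AB: "(A \<star> B) i l = (\<Sum>k\<in>R. A i k * B k l)" for l
    by (rule smult_mat_eq_sum) (use fin in \<open>auto simp: R_def\<close>)
  have BC: "(B \<star> C) k j = (\<Sum>l\<in>S. B k l * C l j)" for k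
    by (rule smult_mat_eq_sum) (use fin in \<open>auto simp: S_def\<close>)
  have "(A \<star> B \<star> C) i j = (\<Sum>l\<in>S. (A \<star> B) i l * C l j)"
    using fin by (intro smult_mat_eq_sum) (auto simp: S_def)
  also have "\<dots> = (\<Sum>k\<in>R. A i k * (B \<star> C) k j)"
    unfolding AB BC sum_distrib_right sum_distrib_left
    by (subst sum.swap) (simp add: mult.assoc)
  also have "\<dots> = (A \<star> (B \<star> C)) i j"
    using fin by (intro smult_mat_eq_sum [symmetric]) (auto simp: R_def)
  finally show "(A \<star> B \<star> C) i j = (A \<star> (B \<star> C)) i j" .
qed

section \<open>Identity, shift and closure properties\<close>

lemma sid_smult_mat [simp]: "sid \<star> A = A"
proof (intro ext)
  fix i j
  show "(sid \<star> A) i j = A i j"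
    using smult_mat_eq_sum [of "{i}" sid i A j] by (simp add: sid_def)
qed

lemma smult_mat_sid [simp]: "A \<star> sid = A"
proof (intro ext)
  fix i j
  show "(A \<star> sid) i j = A i j"
    using smult_mat_eq_sum [of "{j}" A i sid j] by (simp add: sid_def)
qed

lemma shift_smult_mat: "(\<Lambda> \<star> A) i j = A (Suc i) j"
  using smult_mat_eq_sum [of "{Suc i}" \<Lambda> i A j] by (simp add: shift_def)

lemma smult_mat_stranspose_shift: "(A \<star> stranspose \<Lambda>) i j = A i (Suc j)"
  using smult_mat_eq_sum [of "{Suc j}" A i "stranspose \<Lambda>" j]
  by (simp add: shift_def stranspose_def)

lemma row_finite_smult_mat:
  assumes "row_finite A" "row_finite B"
  shows "row_finite (A \<star> B)"
  unfolding row_finite_def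
proof
  fix i
  define S where "S = (\<Union>k\<in>{k. A i k \<noteq> 0}. {l. B k l \<noteq> 0})"
  have "finite S"
    using assms by (auto simp: S_def row_finite_def)
  moreover have "(A \<star> B) i l = 0" if "l \<notin> S" for l
  proof -
    have "A i k * B k l = 0" for k
      using that by (auto simp: S_def)
    then show ?thesis
      by (simp add: smult_mat_eq_sum [of "{}"])
  qed
  ultimately show "finite {l. (A \<star> B) i l \<noteq> 0}"
    by (metis (mono_tags, lifting) finite_subset mem_Collect_eq subsetI)
qed

lemma row_finite_sid: "row_finite sid"
  by (simp add: row_finite_def sid_def)

lemma row_finite_shift: "row_finite \<Lambda>"
  by (simp add: row_finite_def shift_def)

lemma col_finite_stranspose_shift: "col_finite (stranspose \<Lambda>)"
  by (simp add: col_finite_def shift_def stranspose_def)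

lemma row_finite_spow: "row_finite A \<Longrightarrow> row_finite (spow A n)"
  by (induction n) (simp_all add: row_finite_sid row_finite_smult_mat)

section \<open>Products of finite lists of matrices\<close>

lemma sprod_Nil: "sprod [] = sid"
  by (simp add: sprod_def)

lemma sprod_Cons: "sprod (A # As) = A \<star> sprod As"
  by (simp add: sprod_def)

lemma row_finite_sprod: "\<forall>A\<in>set As. row_finite A \<Longrightarrow> row_finite (sprod As)"
  by (induction As) (simp_all add: sprod_Nil sprod_Cons row_finite_sid row_finite_smult_mat)

lemma sprod_append:
  assumes "\<forall>A\<in>set As. row_finite A"
  shows "sprod (As @ Bs) = sprod As \<star> sprod Bs"
  using assms
  by (induction As) (simp_all add: sprod_Nil sprod_Cons smult_mat_assoc_row_row row_finite_sprod)

section \<open>Triangular matrices and their inverses\<close>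

lemma row_finite_lower_unitriangular: "lower_unitriangular A \<Longrightarrow> row_finite A"
  unfolding row_finite_def lower_unitriangular_def
  by (metis (mono_tags, lifting) finite_atMost finite_subset atMost_iff mem_Collect_eq not_le subsetI)

lemma col_finite_supper_triangular: "supper_triangular A \<Longrightarrow> col_finite A"
  unfolding col_finite_def supper_triangular_def
  by (metis (mono_tags, lifting) finite_atMost finite_subset atMost_iff mem_Collect_eq not_le subsetI)

lemma lower_smult_mat_eq_sum:
  "lower_unitriangular A \<Longrightarrow> (A \<star> B) i j = (\<Sum>k\<le>i. A i k * B k j)"
  by (rule smult_mat_eq_sum) (auto simp: lower_unitriangular_def)

lemma smult_upper_mat_eq_sum:
  "supper_triangular B \<Longrightarrow> (A \<star> B) i j = (\<Sum>k\<le>j. A i k * B k j)"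
  by (rule smult_mat_eq_sum) (auto simp: supper_triangular_def)

lemma lower_unitriangular_smult_mat:
  assumes "lower_unitriangular A" "lower_unitriangular B"
  shows "lower_unitriangular (A \<star> B)"
proof -
  have "(A \<star> B) i i = 1" for i
  proof -
    have "(\<Sum>k<i. A i k * B k i) = 0"
      using assms by (intro sum.neutral) (auto simp: lower_unitriangular_def)
    then show ?thesis
      using assms
      by (simp add: lower_smult_mat_eq_sum lessThan_Suc_atMost [symmetric])
        (simp add: lower_unitriangular_def)
  qed
  moreover have "(A \<star> B) i j = 0" if "i < j" for i j
    unfolding lower_smult_mat_eq_sum [OF assms(1)]
    using assms that by (intro sum.neutral) (auto simp: lower_unitriangular_def)
  ultimately show ?thesis
    by (simp add: lower_unitriangular_def)
qed

lemma supper_triangular_smult_mat: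
  assumes "supper_triangular A" "supper_triangular B"
  shows "supper_triangular (A \<star> B)"
  unfolding supper_triangular_def
proof (intro allI impI)
  fix i j :: nat assume "j < i"
  then show "(A \<star> B) i j = 0"
    unfolding smult_upper_mat_eq_sum [OF assms(2)]
    using assms by (intro sum.neutral) (auto simp: supper_triangular_def)
qed

text \<open>Forward substitution: the unit diagonal lets row \<open>i\<close> of the equation
  \<open>A \<star> W = sid\<close> be solved for row \<open>i\<close> of \<open>W\<close> in terms
  of the earlier rows.\<close>

lemma lower_unitriangular_right_inverse:
  assumes "lower_unitriangular A"
  shows "\<exists>B. lower_unitriangular B \<and> A \<star> B = sid"
proof -
  define W where
    "W = wfrec less_than (\<lambda>f i j. sid i j - (\<Sum>k<i. A i k * f k j))"
  have W: "W i j = sid i j - (\<Sum>k<i. A i k * W k j)" for i j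
  proof -
    have "W i = (\<lambda>j. sid i j - (\<Sum>k<i. A i k * cut W less_than i k j))"
      unfolding W_def by (subst wfrec) auto
    \<comment> \<open>The sum uses \<open>cut\<close> only at indices \<open>k < i\<close>, where it
      agrees with \<open>W\<close>.\<close>
    then show ?thesis
      by (simp add: cut_def)
  qed
  have upper: "W i j = 0" if "i < j" for i j
    using that
  proof (induction i rule: less_induct)
    case (less i)
    have "(\<Sum>k<i. A i k * W k j) = 0"
      using less by (intro sum.neutral) auto
    then show ?case
      using less.prems by (simp add: W [of i j] sid_def)
  qed
  have diag: "W i i = 1" for i
  proof -
    have "(\<Sum>k<i. A i k * W k i) = 0"
      by (intro sum.neutral) (auto simp: upper)
    then show ?thesis
      by (simp add: W [of i i] sid_def)
  qed
  have "A \<star> W = sid"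
  proof (intro ext)
    fix i j
    have "(A \<star> W) i j = (\<Sum>k<i. A i k * W k j) + A i i * W i j"
      using assms by (simp add: lower_smult_mat_eq_sum lessThan_Suc_atMost [symmetric])
    also have "\<dots> = sid i j"
      using assms W [of i j] by (simp add: lower_unitriangular_def)
    finally show "(A \<star> W) i j = sid i j" .
  qed
  then show ?thesis
    using upper diag by (auto simp: lower_unitriangular_def)
qed

text \<open>The right inverse \<open>B\<close> of \<open>A\<close> has a right inverse
  \<open>C\<close> of its own. Reassociating \<open>A \<star> B \<star> C\<close> gives
  \<open>C = A\<close>, so \<open>B\<close> is two-sided. The value of \<open>THE\<close> then
  follows from \<open>D = B \<star> A \<star> D = B\<close>.\<close>

lemma lower_unitriangular_sinverse:
  assumes A: "lower_unitriangular A"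
  shows "lower_unitriangular (sinverse A)" "A \<star> sinverse A = sid" "sinverse A \<star> A = sid"
proof -
  obtain B where B: "lower_unitriangular B" "A \<star> B = sid"
    using lower_unitriangular_right_inverse [OF A] by blast
  obtain C where C: "lower_unitriangular C" "B \<star> C = sid"
    using lower_unitriangular_right_inverse [OF B(1)] by blast
  have "A \<star> B \<star> C = A \<star> (B \<star> C)"
    using A B(1) by (simp add: smult_mat_assoc_row_row row_finite_lower_unitriangular)
  then have inv: "is_sinverse A B"
    using B C by (simp add: is_sinverse_def)
  have "sinverse A = B"
    unfolding sinverse_def
  proof (rule the_equality)
    show "is_sinverse A B" by (fact inv)
  next
    fix D assume "is_sinverse A D"
    moreover have "B \<star> A \<star> D = B \<star> (A \<star> D)"
      using A B(1) by (simp add: smult_mat_assoc_row_row row_finite_lower_unitriangular)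
    ultimately show "D = B"
      using inv by (simp add: is_sinverse_def)
  qed
  then show "lower_unitriangular (sinverse A)" "A \<star> sinverse A = sid" "sinverse A \<star> A = sid"
    using B inv by (simp_all add: is_sinverse_def)
qed

text \<open>\<open>snonsingular\<close> promises some two-sided inverse of unknown shape. Its
  triangularity supplies the column-finiteness needed to reassociate, and hence the uniqueness
  behind \<open>sinverse U\<close>.\<close>

lemma supper_triangular_is_sinverse:
  assumes U: "supper_triangular U" and inv: "is_sinverse U B"
  shows "supper_triangular B"
proof -
  have "\<forall>i>j. B i j = 0" for j
  proof (induction j rule: less_induct)
    case (less j)
    \<comment> \<open>Entry \<open>(i, j)\<close> of \<open>B \<star> U = sid\<close> on or below
      the diagonal: the induction hypothesis kills the earlier columns of \<open>B\<close> there,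
      and only \<open>k = j\<close> survives. The case \<open>i = j\<close> then forces a nonzero
      pivot \<open>U j j\<close>.\<close>
    have eq: "B i j * U j j = sid i j" if "j \<le> i" for i
    proof -
      have "(\<Sum>k<j. B i k * U k j) = 0"
        using less that by (intro sum.neutral) auto
      moreover have "(B \<star> U) i j = (\<Sum>k<j. B i k * U k j) + B i j * U j j"
        using U by (simp add: smult_upper_mat_eq_sum lessThan_Suc_atMost [symmetric])
      ultimately show ?thesis
        using inv by (simp add: is_sinverse_def)
    qed
    from eq [of j] have "U j j \<noteq> 0"
      by (auto simp: sid_def)
    with eq show ?case
      by (metis less_imp_le mult_eq_0_iff nat_neq_iff sid_def)
  qed
  then show ?thesis
    by (simp add: supper_triangular_def)
qed

lemma supper_triangular_sinverse:
  assumes U: "supper_triangular U" and "snonsingular U"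
  shows "supper_triangular (sinverse U)" "U \<star> sinverse U = sid" "sinverse U \<star> U = sid"
proof -
  obtain B where inv: "is_sinverse U B"
    using assms(2) by (auto simp: snonsingular_def)
  have "sinverse U = B"
    unfolding sinverse_def
  proof (rule the_equality)
    show "is_sinverse U B" by (fact inv)
  next
    fix D assume D: "is_sinverse U D"
    \<comment> \<open>Reassociating here uses that the competing inverse \<open>D\<close> is
      column-finite, which comes from its triangularity.\<close>
    have "B \<star> U \<star> D = B \<star> (U \<star> D)"
      using U supper_triangular_is_sinverse [OF U D]
      by (simp add: smult_mat_assoc_col_col col_finite_supper_triangular)
    then show "D = B"
      using inv D by (simp add: is_sinverse_def)
  qed
  then show "supper_triangular (sinverse U)" "U \<star> sinverse U = sid" "sinverse U \<star> U = sid"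
    using inv supper_triangular_is_sinverse [OF U inv] by (simp_all add: is_sinverse_def)
qed

section \<open>Gauss--Borel factorizations\<close>

lemma gauss_borelD:
  assumes "gauss_borel M L U"
  shows "lower_unitriangular L" "supper_triangular U" "snonsingular U"
    and "L \<star> M = sinverse U" "M \<star> U = sinverse L"
proof -
  show L: "lower_unitriangular L" and U: "supper_triangular U" "snonsingular U"
    using assms by (simp_all add: gauss_borel_def)
  have M: "M = sinverse L \<star> sinverse U"
    using assms by (simp add: gauss_borel_def)
  note Li = lower_unitriangular_sinverse [OF L] and Ui = supper_triangular_sinverse [OF U]
  have "L \<star> sinverse L \<star> sinverse U = L \<star> (sinverse L \<star> sinverse U)"
    by (intro smult_mat_assoc_row_row row_finite_lower_unitriangular L Li)
  then show "L \<star> M = sinverse U"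
    by (simp add: M Li)
  have "sinverse L \<star> sinverse U \<star> U = sinverse L \<star> (sinverse U \<star> U)"
    by (intro smult_mat_assoc_col_col col_finite_supper_triangular U Ui)
  then show "M \<star> U = sinverse L"
    by (simp add: M Ui)
qed

text \<open>Evaluating \<open>L' \<star> M \<star> U\<close> in two ways equates
  \<open>L' \<star> sinverse L\<close>, which is lower unitriangular, with
  \<open>sinverse U' \<star> U\<close>, which is upper triangular. Both are then the
  identity.\<close>

lemma gauss_borel_lower_unique:
  assumes "gauss_borel M L U" "gauss_borel M L' U'"
  shows "L = L'"
proof -
  note G = gauss_borelD [OF assms(1)] and G' = gauss_borelD [OF assms(2)]
  note Li = lower_unitriangular_sinverse [OF G(1)]
    and Ui' = supper_triangular_sinverse [OF G'(2,3)]
  define D where "D = L' \<star> sinverse L"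
  have "L' \<star> M \<star> U = L' \<star> (M \<star> U)"
    by (intro smult_mat_assoc_row_col row_finite_lower_unitriangular
        col_finite_supper_triangular G G')
  then have "D = sinverse U' \<star> U"
    by (simp add: D_def G G')
  then have upper: "supper_triangular D"
    using supper_triangular_smult_mat [OF Ui'(1) G(2)] by simp
  have lower: "lower_unitriangular D"
    unfolding D_def by (intro lower_unitriangular_smult_mat G' Li)
  have "D = sid"
    using upper lower
    by (auto simp: supper_triangular_def lower_unitriangular_def sid_def fun_eq_iff
        dest: nat_neq_iff [THEN iffD1])
  moreover have "L' \<star> sinverse L \<star> L = L' \<star> (sinverse L \<star> L)"
    by (intro smult_mat_assoc_row_row row_finite_lower_unitriangular G' Li)
  ultimately show ?thesis
    by (simp add: D_def Li)
qed

text \<open>The equivalence yields existence and uniqueness at once, and so also evaluates the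
  \<open>THE\<close> in \<open>lower_factor\<close>. The bidiagonal shape comes from two expressions
  for the same matrix: a quotient of lower factors, and the product \<open>sinverse (UL (k - 1))
  \<star> stranspose \<Lambda> \<star> UL k\<close>, which is upper Hessenberg.\<close>

lemma lower_factor_eq:
  assumes prev: "gauss_borel M (LL (k - 1)) (UL (k - 1))"
    and cur: "gauss_borel (M \<star> stranspose \<Lambda>) (LL k) (UL k)"
  shows "is_lower_factor UL k L \<longleftrightarrow> L = LL (k - 1) \<star> sinverse (LL k)"
proof -
  note G = gauss_borelD [OF prev] and G' = gauss_borelD [OF cur]
  note Li' = lower_unitriangular_sinverse [OF G'(1)]
    and Ui = supper_triangular_sinverse [OF G(2,3)]
    and Ui' = supper_triangular_sinverse [OF G'(2,3)]
  define X where "X = LL (k - 1) \<star> sinverse (LL k)"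
  have X: "lower_unitriangular X"
    unfolding X_def by (intro lower_unitriangular_smult_mat G Li')
  have "X \<star> sinverse (UL k) = LL (k - 1) \<star> (sinverse (LL k) \<star> sinverse (UL k))"
    unfolding X_def by (intro smult_mat_assoc_row_row row_finite_lower_unitriangular G Li')
  also have "\<dots> = LL (k - 1) \<star> (M \<star> stranspose \<Lambda>)"
    using cur by (simp add: gauss_borel_def)
  also have "\<dots> = LL (k - 1) \<star> M \<star> stranspose \<Lambda>"
    by (intro smult_mat_assoc_row_col [symmetric] row_finite_lower_unitriangular G
        col_finite_stranspose_shift)
  finally have eq: "X \<star> sinverse (UL k) = sinverse (UL (k - 1)) \<star> stranspose \<Lambda>"
    by (simp only: G(4))
  \<comment> \<open>\<open>Y\<close> is arbitrary, so this serves both to rewrite \<open>X\<close>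
    and to compare \<open>X\<close> with any other solution \<open>L\<close>.\<close>
  have cancel: "Y \<star> sinverse (UL k) \<star> UL k = Y" for Y
  proof -
    have "Y \<star> sinverse (UL k) \<star> UL k = Y \<star> (sinverse (UL k) \<star> UL k)"
      by (intro smult_mat_assoc_col_col col_finite_supper_triangular G' Ui')
    then show ?thesis
      by (simp add: Ui')
  qed
  have "X = sinverse (UL (k - 1)) \<star> stranspose \<Lambda> \<star> UL k"
    using cancel [of X] by (simp add: eq)
  then have "X i j = (\<Sum>l\<le>j. sinverse (UL (k - 1)) i (Suc l) * UL k l j)" for i j
    using G'(2) by (simp add: smult_upper_mat_eq_sum smult_mat_stranspose_shift)
  \<comment> \<open>Each summand has \<open>Suc l \<le> Suc j < i\<close>, hence an entry of
    \<open>sinverse (UL (k - 1))\<close> below the diagonal.\<close>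
  then have hessenberg: "X i j = 0" if "Suc j < i" for i j
    using that Ui(1) by (auto simp: supper_triangular_def intro!: sum.neutral)
  have "unit_lower_bidiagonal X"
    unfolding unit_lower_bidiagonal_def
  proof (intro conjI allI impI)
    fix i j assume "j \<noteq> i \<and> i \<noteq> Suc j"
    then have "i < j \<or> Suc j < i"
      by linarith
    then show "X i j = 0"
      using X hessenberg by (auto simp: lower_unitriangular_def)
  qed (use X in \<open>simp add: lower_unitriangular_def\<close>)
  then have "is_lower_factor UL k X"
    by (simp add: is_lower_factor_def eq)
  moreover have "L = X" if "is_lower_factor UL k L"
    using that cancel [of L] cancel [of X] by (simp add: is_lower_factor_def eq)
  ultimately show ?thesis
    unfolding X_def by blast
qed

text \<open>The mirror image: the candidate equals
  \<open>sinverse (UR k) \<star> UR (k - 1)\<close>, hence is upper triangular, while the shift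
  between two lower unitriangular matrices allows nothing beyond the first superdiagonal.\<close>

lemma upper_factor_eq:
  assumes prev: "gauss_borel M (LR (k - 1)) (UR (k - 1))"
    and cur: "gauss_borel (\<Lambda> \<star> M) (LR k) (UR k)"
  shows "is_upper_factor LR k U \<longleftrightarrow> U = LR k \<star> (\<Lambda> \<star> sinverse (LR (k - 1)))"
proof -
  note G = gauss_borelD [OF prev] and G' = gauss_borelD [OF cur]
  note Li = lower_unitriangular_sinverse [OF G(1)]
    and Li' = lower_unitriangular_sinverse [OF G'(1)]
    and Ui' = supper_triangular_sinverse [OF G'(2,3)]
  define X where "X = LR k \<star> (\<Lambda> \<star> sinverse (LR (k - 1)))"
  have "sinverse (LR k) \<star> X = sinverse (LR k) \<star> LR k \<star> (\<Lambda> \<star> sinverse (LR (k - 1)))"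
    unfolding X_def
    by (intro smult_mat_assoc_row_row [symmetric] row_finite_lower_unitriangular G' Li')
  then have eq: "sinverse (LR k) \<star> X = \<Lambda> \<star> sinverse (LR (k - 1))"
    by (simp add: Li')
  have cancel: "LR k \<star> (sinverse (LR k) \<star> Y) = Y" for Y
  proof -
    have "LR k \<star> (sinverse (LR k) \<star> Y) = LR k \<star> sinverse (LR k) \<star> Y"
      by (intro smult_mat_assoc_row_row [symmetric] row_finite_lower_unitriangular G' Li')
    then show ?thesis
      by (simp add: Li')
  qed
  have "\<Lambda> \<star> sinverse (LR (k - 1)) = \<Lambda> \<star> M \<star> UR (k - 1)"
    unfolding G(5) [symmetric]
    by (intro smult_mat_assoc_row_col [symmetric] row_finite_shift
        col_finite_supper_triangular G)
  then have "X = LR k \<star> (\<Lambda> \<star> M \<star> UR (k - 1))"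
    by (simp add: X_def)
  also have "\<dots> = LR k \<star> (\<Lambda> \<star> M) \<star> UR (k - 1)"
    by (intro smult_mat_assoc_row_col [symmetric] row_finite_lower_unitriangular
        col_finite_supper_triangular G G')
  finally have upper: "supper_triangular X"
    by (simp only: G'(4) supper_triangular_smult_mat [OF Ui'(1) G(2)])
  have X: "X i j = (\<Sum>l\<le>i. LR k i l * sinverse (LR (k - 1)) (Suc l) j)" for i j
    unfolding X_def using G'(1) by (simp add: lower_smult_mat_eq_sum shift_smult_mat)
  have hessenberg: "X i j = 0" if "Suc i < j" for i j
    using that Li(1) by (auto simp: X lower_unitriangular_def intro!: sum.neutral)
  \<comment> \<open>Only \<open>l = i\<close> contributes, and there both factors are unit diagonal
    entries.\<close>
  have superdiagonal: "X i (Suc i) = 1" for i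
  proof -
    have "(\<Sum>l<i. LR k i l * sinverse (LR (k - 1)) (Suc l) (Suc i)) = 0"
      using Li(1) by (intro sum.neutral) (auto simp: lower_unitriangular_def)
    then show ?thesis
      using G'(1) Li(1)
      by (simp add: X lessThan_Suc_atMost [symmetric]) (simp add: lower_unitriangular_def)
  qed
  have "unit_upper_bidiagonal X"
    unfolding unit_upper_bidiagonal_def
  proof (intro conjI allI impI)
    fix i j assume "j \<noteq> i \<and> j \<noteq> Suc i"
    then have "j < i \<or> Suc i < j"
      by linarith
    then show "X i j = 0"
      using upper hessenberg by (auto simp: supper_triangular_def)
  qed (rule superdiagonal)
  then have "is_upper_factor LR k X"
    by (simp add: is_upper_factor_def eq)
  moreover have "U = X" if "is_upper_factor LR k U"
    using that cancel [of U] cancel [of X] by (simp add: is_upper_factor_def eq)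
  ultimately show ?thesis
    unfolding X_def by blast
qed

section \<open>Moment matrices of the Christoffel perturbations\<close>

lemma christoffel_pow_carrier [simp]: "christoffel_mat r x ^\<^sub>m k \<in> carrier_mat r r"
  by (intro pow_carrier_mat) (simp add: christoffel_mat_def)

lemma monomial_blocks_eq:
  assumes "b < r"
  shows "monomial_blocks r x n b = (if n mod r = b then x ^ (n div r) else 0)"
  using assms by (auto simp: monomial_blocks_def)

text \<open>Row \<open>n\<close> has the single entry \<open>x ^ (n div r)\<close> in column
  \<open>n mod r\<close>. The Christoffel matrix moves it one column to the right; from the last
  column it wraps to column 0 and gains a factor \<open>x\<close>, exactly the carry in
  \<open>Suc n div r\<close>.\<close>

lemma monomial_blocks_christoffel_mat:
  assumes "b < r"
  shows "(\<Sum>c<r. monomial_blocks r x n c * christoffel_mat r x $$ (c, b)) =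
    monomial_blocks r x (Suc n) b"
proof -
  have r: "n mod r < r"
    using assms by simp
  have "(\<Sum>c<r. monomial_blocks r x n c * christoffel_mat r x $$ (c, b)) =
      (\<Sum>c<r. if c = n mod r then x ^ (n div r) * christoffel_mat r x $$ (c, b) else 0)"
    by (intro sum.cong) (auto simp: monomial_blocks_eq)
  also have "\<dots> = x ^ (n div r) * christoffel_mat r x $$ (n mod r, b)"
    using r by simp
  also have "\<dots> = monomial_blocks r x (Suc n) b"
    using assms r
    by (auto simp: monomial_blocks_eq christoffel_mat_def mod_Suc div_Suc)
  finally show ?thesis .
qed

lemma monomial_blocks_christoffel_pow:
  assumes "b < r"
  shows "(\<Sum>c<r. monomial_blocks r x n c * (christoffel_mat r x ^\<^sub>m k) $$ (c, b)) =
    monomial_blocks r x (n + k) b"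
  using assms
proof (induction k arbitrary: b)
  case 0
  have "(\<Sum>c<r. monomial_blocks r x n c * (christoffel_mat r x ^\<^sub>m 0) $$ (c, b)) =
      (\<Sum>c<r. if c = b then monomial_blocks r x n c else 0)"
    using 0 by (intro sum.cong) (auto simp: christoffel_mat_def)
  then show ?case
    using 0 by simp
next
  case (Suc k)
  let ?C = "christoffel_mat r x"
  have C: "?C \<in> carrier_mat r r"
    by (simp add: christoffel_mat_def)
  \<comment> \<open>The power unfolds with the new factor on the right, so the induction hypothesis
    first advances the row index to \<open>n + k\<close> and the last factor advances it once
    more.\<close>
  have "(?C ^\<^sub>m Suc k) $$ (c, b) = (\<Sum>e<r. (?C ^\<^sub>m k) $$ (c, e) * ?C $$ (e, b))"
    if "c < r" for c
    using that Suc.prems C christoffel_pow_carrier [of r x k]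
    by (simp add: scalar_prod_def atLeast0LessThan)
  then have "(\<Sum>c<r. monomial_blocks r x n c * (?C ^\<^sub>m Suc k) $$ (c, b)) =
      (\<Sum>c<r. \<Sum>e<r. monomial_blocks r x n c * ((?C ^\<^sub>m k) $$ (c, e) * ?C $$ (e, b)))"
    by (intro sum.cong) (auto simp: sum_distrib_left)
  also have "\<dots> = (\<Sum>e<r. (\<Sum>c<r. monomial_blocks r x n c * (?C ^\<^sub>m k) $$ (c, e)) * ?C $$ (e, b))"
    by (subst sum.swap) (simp add: sum_distrib_right mult.assoc)
  also have "\<dots> = (\<Sum>e<r. monomial_blocks r x (n + k) e * ?C $$ (e, b))"
    using Suc.IH by (intro sum.cong) auto
  also have "\<dots> = monomial_blocks r x (n + Suc k) b"
    using monomial_blocks_christoffel_mat [OF Suc.prems] by simp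
  finally show ?case .
qed

text \<open>A shift by a whole block is multiplication by \<open>x\<close>: the row version of the
  statement that the \<open>r\<close>-th power of the Christoffel matrix is \<open>x\<close> times
  the identity.\<close>

lemma monomial_blocks_add_period:
  "b < r \<Longrightarrow> monomial_blocks r x (n + r) b = x * monomial_blocks r x n b"
  by (simp add: monomial_blocks_eq)

lemma monomial_blocks_one_mat:
  "b < r \<Longrightarrow> (\<Sum>c<r. monomial_blocks r x n c * 1\<^sub>m r $$ (c, b)) = monomial_blocks r x n b"
  using monomial_blocks_christoffel_pow [of b r x n 0] by (simp add: christoffel_mat_def)

lemma monomial_blocks_transpose:
  assumes "C \<in> carrier_mat r r" "a < r"
  shows "(\<Sum>d<r. transpose_mat C $$ (a, d) * monomial_blocks r x n d) =
    (\<Sum>d<r. monomial_blocks r x n d * C $$ (d, a))"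
  using assms by (intro sum.cong) auto

section \<open>Christoffel perturbations as index shifts of the moment matrix\<close>

lemma moment_matrix_L_eq:
  "moment_matrix_L q p \<mu> k i j = (\<Sum>b<q. \<Sum>a<p. rm_integral (\<mu> b a)
     (\<lambda>x. monomial_blocks q x i b * monomial_blocks p x (j + k) a))"
  unfolding moment_matrix_L_def moment_matrix_def
  by (intro sum.cong refl)
    \<comment> \<open>The entries of the identity matrix stay folded so that
      \<open>monomial_blocks_one_mat\<close> can match.\<close>
    (simp del: index_one_mat
      add: monomial_blocks_one_mat monomial_blocks_transpose monomial_blocks_christoffel_pow)

lemma moment_matrix_R_eq:
  "moment_matrix_R q p \<mu> k i j = (\<Sum>b<q. \<Sum>a<p. rm_integral (\<mu> b a)
     (\<lambda>x. monomial_blocks q x (i + k) b * monomial_blocks p x j a))"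
proof -
  have "(\<Sum>d<p. 1\<^sub>m p $$ (a, d) * monomial_blocks p x j d) = monomial_blocks p x j a"
    if "a < p" for a x
    using that monomial_blocks_transpose [of "1\<^sub>m p" p a x j]
    by (simp del: index_one_mat add: monomial_blocks_one_mat)
  then show ?thesis
    unfolding moment_matrix_R_def moment_matrix_def
    by (intro sum.cong refl) (simp add: monomial_blocks_christoffel_pow)
qed

lemma moment_matrix_L_Suc:
  "moment_matrix_L q p \<mu> (Suc k) = moment_matrix_L q p \<mu> k \<star> stranspose \<Lambda>"
  by (intro ext) (simp add: smult_mat_stranspose_shift moment_matrix_L_eq)

lemma moment_matrix_R_Suc:
  "moment_matrix_R q p \<mu> (Suc k) = \<Lambda> \<star> moment_matrix_R q p \<mu> k"
  by (intro ext) (simp add: shift_smult_mat moment_matrix_R_eq)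

lemma moment_matrix_L_0_eq_R_0: "moment_matrix_L q p \<mu> 0 = moment_matrix_R q p \<mu> 0"
  by (intro ext) (simp add: moment_matrix_L_eq moment_matrix_R_eq)

text \<open>Shifting the column index by \<open>p\<close> and shifting the row index by
  \<open>q\<close> both multiply every integrand by \<open>x\<close>. This is the identity between
  \<open>\<Lambda>\<close> to the power \<open>q\<close> acting on the left and its transposed power
  \<open>p\<close> acting on the right.\<close>

lemma moment_matrix_L_eq_R: "moment_matrix_L q p \<mu> p = moment_matrix_R q p \<mu> q"
  by (intro ext)
    (simp add: moment_matrix_L_eq moment_matrix_R_eq monomial_blocks_add_period mult_ac)

section \<open>The bidiagonal factorization\<close>

lemma sprod_lower_telescope:
  assumes "\<And>k. k \<le> n \<Longrightarrow> lower_unitriangular (LL k)"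
    and "\<And>k. 1 \<le> k \<Longrightarrow> k \<le> n \<Longrightarrow> F k = LL (k - 1) \<star> sinverse (LL k)"
  shows "sprod (map F [1..<Suc n]) = LL 0 \<star> sinverse (LL n)"
  using assms
proof (induction n)
  case 0
  then show ?case
    by (simp add: sprod_Nil lower_unitriangular_sinverse)
next
  case (Suc n)
  have rf: "row_finite (LL k)" "row_finite (sinverse (LL k))" if "k \<le> Suc n" for k
    using that Suc.prems(1)
    by (simp_all add: row_finite_lower_unitriangular lower_unitriangular_sinverse)
  have rfF: "row_finite (F k)" if "1 \<le> k" "k \<le> Suc n" for k
    using that by (simp add: Suc.prems(2) row_finite_smult_mat rf)
  \<comment> \<open>The list is split at its end, so the new factor enters on the right, next to
    \<open>sinverse (LL n)\<close>.\<close>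
  have "sprod (map F [1..<Suc (Suc n)]) = sprod (map F [1..<Suc n]) \<star> F (Suc n)"
    using rfF by (simp add: sprod_append sprod_Cons sprod_Nil del: upt_Suc add: upt_Suc_append)
  also have "\<dots> = LL 0 \<star> sinverse (LL n) \<star> (LL n \<star> sinverse (LL (Suc n)))"
    using Suc by simp
  also have "\<dots> = LL 0 \<star> (sinverse (LL n) \<star> LL n \<star> sinverse (LL (Suc n)))"
    by (simp add: smult_mat_assoc_row_row rf)
  also have "\<dots> = LL 0 \<star> sinverse (LL (Suc n))"
    using Suc.prems(1) by (simp add: lower_unitriangular_sinverse)
  finally show ?case .
qed

text \<open>In the reversed list the new factor enters on the left. Its
  \<open>sinverse (LR n)\<close> cancels the leading \<open>LR n\<close> of the earlier product, and
  its \<open>\<Lambda>\<close> then joins the accumulated power.\<close>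

lemma sprod_upper_telescope:
  assumes "\<And>k. k \<le> n \<Longrightarrow> lower_unitriangular (LR k)"
    and "\<And>k. 1 \<le> k \<Longrightarrow> k \<le> n \<Longrightarrow> F k = LR k \<star> (\<Lambda> \<star> sinverse (LR (k - 1)))"
  shows "sprod (map F (rev [1..<Suc n])) = LR n \<star> (spow \<Lambda> n \<star> sinverse (LR 0))"
  using assms
proof (induction n)
  case 0
  then show ?case
    by (simp add: sprod_Nil lower_unitriangular_sinverse)
next
  case (Suc n)
  have rf: "row_finite (LR k)" "row_finite (sinverse (LR k))" if "k \<le> Suc n" for k
    using that Suc.prems(1)
    by (simp_all add: row_finite_lower_unitriangular lower_unitriangular_sinverse)
  note rf = rf row_finite_shift row_finite_spow [OF row_finite_shift]
  have "sprod (map F (rev [1..<Suc (Suc n)])) = F (Suc n) \<star> sprod (map F (rev [1..<Suc n]))"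
    by (simp add: sprod_Cons)
  also have "\<dots> = LR (Suc n) \<star> (\<Lambda> \<star> sinverse (LR n)) \<star> (LR n \<star> (spow \<Lambda> n \<star> sinverse (LR 0)))"
    using Suc by simp
  also have "\<dots> = LR (Suc n) \<star> (\<Lambda> \<star> (sinverse (LR n) \<star> LR n \<star> (spow \<Lambda> n \<star> sinverse (LR 0))))"
    by (simp add: smult_mat_assoc_row_row row_finite_smult_mat rf)
  also have "\<dots> = LR (Suc n) \<star> (spow \<Lambda> (Suc n) \<star> sinverse (LR 0))"
    using Suc.prems(1) by (simp add: lower_unitriangular_sinverse smult_mat_assoc_row_row rf)
  finally show ?case .
qed

theorem theorem4p2:
  fixes p q :: nat
    and \<Delta> :: "real set"
    and \<mu> :: "nat \<Rightarrow> nat \<Rightarrow> real_measure"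
    and LL UL LR UR :: "nat \<Rightarrow> smat"
  assumes "p \<ge> 1" and "q \<ge> 1"
    and "is_interval \<Delta>"
    and "matrix_of_measures q p \<Delta> \<mu>"
    and "\<And>k. k \<le> p \<Longrightarrow> gauss_borel (moment_matrix_L q p \<mu> k) (LL k) (UL k)"
    and "\<And>k. k \<le> q \<Longrightarrow> gauss_borel (moment_matrix_R q p \<mu> k) (LR k) (UR k)"
  shows "(\<forall>k\<in>{1..p}. \<exists>!L. is_lower_factor UL k L) \<and>
         (\<forall>k\<in>{1..q}. \<exists>!U. is_upper_factor LR k U) \<and>
         recurrence_matrix q (LL 0) =
           sprod (map (lower_factor UL) [1..<Suc p] @ map (upper_factor LR) (rev [1..<Suc q]))"
proof -
  note GL = assms(5) and GR = assms(6)
  have lower: "is_lower_factor UL k L \<longleftrightarrow> L = LL (k - 1) \<star> sinverse (LL k)"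
    if "1 \<le> k" "k \<le> p" for k L
    using lower_factor_eq [of "moment_matrix_L q p \<mu> (k - 1)" LL k UL L]
      GL [of "k - 1"] GL [of k] that
    by (simp add: moment_matrix_L_Suc [symmetric])
  have upper: "is_upper_factor LR k U \<longleftrightarrow> U = LR k \<star> (\<Lambda> \<star> sinverse (LR (k - 1)))"
    if "1 \<le> k" "k \<le> q" for k U
    using upper_factor_eq [of "moment_matrix_R q p \<mu> (k - 1)" LR k UR U]
      GR [of "k - 1"] GR [of k] that
    by (simp add: moment_matrix_R_Suc [symmetric])
  have lower_eq: "lower_factor UL k = LL (k - 1) \<star> sinverse (LL k)" if "1 \<le> k" "k \<le> p" for k
    using that by (simp add: lower_factor_def lower)
  have upper_eq: "upper_factor LR k = LR k \<star> (\<Lambda> \<star> sinverse (LR (k - 1)))"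
    if "1 \<le> k" "k \<le> q" for k
    using that by (simp add: upper_factor_def upper)
  have LL: "lower_unitriangular (LL k)" if "k \<le> p" for k
    using GL [OF that] by (rule gauss_borelD)
  have LR: "lower_unitriangular (LR k)" if "k \<le> q" for k
    using GR [OF that] by (rule gauss_borelD)
  \<comment> \<open>Both chains start from the same moment matrix, so the right-hand chain also ends
    in \<open>sinverse (LL 0)\<close>, as \<open>recurrence_matrix q (LL 0)\<close>
    requires.\<close>
  have zero: "LR 0 = LL 0"
    using gauss_borel_lower_unique GL [of 0] GR [of 0] by (simp add: moment_matrix_L_0_eq_R_0)
  have last: "LR q = LL p"
    using gauss_borel_lower_unique GL [of p] GR [of q] by (simp add: moment_matrix_L_eq_R)
  have rf: "row_finite (LL k)" "row_finite (sinverse (LL k))" if "k \<le> p" for k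
    using LL [OF that]
    by (simp_all add: row_finite_lower_unitriangular lower_unitriangular_sinverse)
  have rf_factor: "row_finite (lower_factor UL k)" if "1 \<le> k" "k \<le> p" for k
    using that by (simp add: lower_eq row_finite_smult_mat rf)
  have "sprod (map (lower_factor UL) [1..<Suc p] @ map (upper_factor LR) (rev [1..<Suc q])) =
      sprod (map (lower_factor UL) [1..<Suc p]) \<star> sprod (map (upper_factor LR) (rev [1..<Suc q]))"
    by (rule sprod_append) (auto simp: rf_factor simp del: upt_Suc)
  also have "\<dots> = LL 0 \<star> sinverse (LL p) \<star> (LL p \<star> (spow \<Lambda> q \<star> sinverse (LL 0)))"
    using sprod_lower_telescope [of p LL "lower_factor UL", OF LL lower_eq]
      sprod_upper_telescope [of q LR "upper_factor LR", OF LR upper_eq]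
    by (simp only: zero last)
  also have "\<dots> = LL 0 \<star> (sinverse (LL p) \<star> LL p \<star> (spow \<Lambda> q \<star> sinverse (LL 0)))"
    by (simp add: smult_mat_assoc_row_row rf)
  also have "\<dots> = recurrence_matrix q (LL 0)"
    by (simp add: recurrence_matrix_def lower_unitriangular_sinverse LL smult_mat_assoc_row_row rf
        row_finite_spow row_finite_shift)
  finally show ?thesis
    using lower upper by auto
qed

end
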